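(* Let $T$ be a perfect binary tree of height $h$. Then the vertex cover number of $T$ is $$\alpha(T)=\frac{2^{h+2}-(3+(-1)^h)}{6}.$$
   Context: A perfect binary tree is a rooted tree in which every non-leaf vertex has exactly two children and all leaves lie at the same distance (number of edges) from the root; this common distance is the height $h$ of the tree. It is regarded as a finite simple graph. A vertex cover of a finite simple graph $G$ is a subset of $V(G)$ meeting every edge of $G$; the vertex cover number $\alpha(G)$ is the smallest cardinality of a vertex cover of $G$. *)

theory Defs
  imports "Graph_Theory.Graph_Theory"
begin

text \<open>
  Finite simple graphs are rendered by the locale \<^locale>\<open>pair_graph\<close>: finite vertex set, and an edge
  \<open>{u, v}\<close> is the pair of arcs \<open>(u, v)\<close>, \<open>(v, u)\<close> of a symmetric irreflexive relation.
\<close>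

definition vertex_cover :: "'a pair_pre_digraph \<Rightarrow> 'a set \<Rightarrow> bool" where
  "vertex_cover G C \<longleftrightarrow> C \<subseteq> pverts G \<and> (\<forall>(u, v) \<in> parcs G. u \<in> C \<or> v \<in> C)"

definition vertex_cover_number :: "'a pair_pre_digraph \<Rightarrow> nat" where
  "vertex_cover_number G = (LEAST k. \<exists>C. vertex_cover G C \<and> card C = k)"

text \<open>
  The constant \<^const>\<open>Digraph_Component.tree\<close> is unsuitable here: it regards \<open>u, v, u\<close> as a cycle,
  so that no symmetric digraph with an edge would be a tree.  In a symmetric loopfree digraph the
  cycles of length at least 3 are exactly the cycles of the undirected graph.
  Connectedness includes having at least one vertex.
\<close>
definition graph_tree :: "'a pair_pre_digraph \<Rightarrow> bool" where
  "graph_tree G \<longleftrightarrow> pair_graph G \<and> Digraph_Component.connected (with_proj G) \<and>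
     \<not> (\<exists>p. pre_digraph.cycle (with_proj G) p \<and> length p \<ge> 3)"

definition rooted_tree :: "'a pair_pre_digraph \<Rightarrow> 'a \<Rightarrow> bool" where
  "rooted_tree G r \<longleftrightarrow> graph_tree G \<and> r \<in> pverts G"

text \<open>\<open>w\<close> is a child of \<open>v\<close> iff the path from the root to \<open>w\<close> has \<open>(v, w)\<close> as its last arc.\<close>
definition children :: "'a pair_pre_digraph \<Rightarrow> 'a \<Rightarrow> 'a \<Rightarrow> 'a set" where
  "children G r v = {w. \<exists>p. pre_digraph.apath (with_proj G) r (p @ [(v, w)]) w}"

text \<open>A leaf is a vertex without children (not: of degree 1), so the one-vertex tree has a leaf.\<close>
definition leaf :: "'a pair_pre_digraph \<Rightarrow> 'a \<Rightarrow> 'a \<Rightarrow> bool" where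
  "leaf G r v \<longleftrightarrow> v \<in> pverts G \<and> children G r v = {}"

definition graph_dist :: "'a pair_pre_digraph \<Rightarrow> 'a \<Rightarrow> 'a \<Rightarrow> ereal" where
  "graph_dist G u v = wf_digraph.\<mu> (with_proj G) (\<lambda>_. 1) u v"

definition perfect_binary_tree :: "'a pair_pre_digraph \<Rightarrow> 'a \<Rightarrow> nat \<Rightarrow> bool" where
  "perfect_binary_tree G r h \<longleftrightarrow> rooted_tree G r \<and>
     (\<forall>v \<in> pverts G. \<not> leaf G r v \<longrightarrow> card (children G r v) = 2) \<and>
     (\<forall>v. leaf G r v \<longrightarrow> graph_dist G r v = ereal (real h))"

end

theory Submission
  imports Defs
begin

text \<open>
  Call the number of arcs on the path from the root to a vertex the level of the vertex.  In a
  perfect binary tree of height \<open>h\<close> the levels \<open>0, \<dots>, h\<close> have \<open>1, 2, 4, \<dots>, 2 ^ h\<close> vertices, and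
  every edge joins a vertex to one of its children, one level deeper.  Hence the levels
  \<open>h - 1, h - 3, \<dots>\<close> together form a vertex cover \<open>C\<close>.  It is a smallest one, because the tree has a
  matching with \<open>card C\<close> edges: match each vertex of \<open>C\<close>, which is not a leaf, with one of its
  children; different vertices have different children, and the children lie on levels that do not
  belong to \<open>C\<close>.  Any vertex cover must contain an endpoint of each of these disjoint edges
  (lemma \<open>vertex_cover_number_eq_card_matched_cover\<close>).  So the vertex cover number is
  \<open>2 ^ (h - 1) + 2 ^ (h - 3) + \<dots>\<close>, and summing this geometric series gives the closed form.

  The levels make sense because a tree has only one path from the root to each vertex
  (\<open>apath_unique\<close>).  Both this and the fact that every arc is directed from parent to child
  or from child to parent (\<open>arc_imp_child\<close>) come from the same source: a path whose ends are adjacent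
  has at most one arc, since closing a longer one would give a cycle
  (\<open>length_apath_between_adjacent\<close>).
\<close>

section \<open>Vertex covers and matchings\<close>

text \<open>
  The edges \<open>{v, m v}\<close> for \<open>v \<in> C\<close> are pairwise disjoint, so choosing from each of them an endpoint
  that lies in a given cover \<open>D\<close> embeds \<open>C\<close> into \<open>D\<close>.
\<close>
lemma vertex_cover_number_eq_card_matched_cover:
  assumes fin: "finite (pverts G)"
    and cover: "vertex_cover G C"
    and arc: "\<And>v. v \<in> C \<Longrightarrow> (v, m v) \<in> parcs G"
    and outside: "\<And>v. v \<in> C \<Longrightarrow> m v \<notin> C"
    and inj: "inj_on m C"
  shows "vertex_cover_number G = card C"
  unfolding vertex_cover_number_def
proof (rule Least_equality)
  show "\<exists>D. vertex_cover G D \<and> card D = card C" using cover by blast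
next
  fix k assume "\<exists>D. vertex_cover G D \<and> card D = k"
  then obtain D where D: "vertex_cover G D" "card D = k" by blast
  define g where "g v = (if v \<in> D then v else m v)" for v
  have "inj_on g C"
    using inj outside by (auto simp: inj_on_def g_def)
  moreover have "g ` C \<subseteq> D"
    using D(1) arc by (fastforce simp: g_def vertex_cover_def)
  moreover have "finite D"
    using D(1) fin by (auto simp: vertex_cover_def dest: finite_subset)
  ultimately show "card C \<le> k"
    using D(2) card_inj_on_le by blast
qed

section \<open>Paths in a rooted tree\<close>

locale rooted_pair_tree = pair_graph G for G :: "'a pair_pre_digraph" +
  fixes r :: 'a
  assumes rooted: "rooted_tree G r"
begin

lemma root_in_pverts: "r \<in> pverts G"
  using rooted by (simp add: rooted_tree_def)

lemma no_long_cycle: "cycle p \<Longrightarrow> length p < 3"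
  using rooted by (auto simp: rooted_tree_def graph_tree_def not_le)

lemma ex_apath_from_root:
  assumes "v \<in> pverts G"
  obtains p where "apath r p v"
proof -
  have "connected G"
    using rooted by (auto simp: rooted_tree_def graph_tree_def)
  then have "strongly_connected G"
    using pair_sym_arcs symmetric_connected_imp_strongly_connected by blast
  then show thesis
    using assms root_in_pverts that by (auto simp: strongly_connected_def reachable_apath)
qed

lemma length_apath_between_adjacent:
  assumes "apath a p b" "(b, a) \<in> parcs G"
  shows "length p < 2"
proof -
  have "cycle ((b, a) # p)"
    using assms unfolding cycle_def apath_def by (auto simp: awalk_Cons_iff)
  from no_long_cycle[OF this] show ?thesis by simp
qed

lemma apath_snoc_iff:
  "apath u (p @ [(a, v)]) v' \<longleftrightarrow>
     v' = v \<and> apath u p a \<and> (a, v) \<in> parcs G \<and> v \<notin> set (pawalk_verts u p)"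
proof
  assume "apath u (p @ [(a, v)]) v'"
  then show "v' = v \<and> apath u p a \<and> (a, v) \<in> parcs G \<and> v \<notin> set (pawalk_verts u p)"
    by (auto simp: apath_append_iff apath_simps)
next
  assume *: "v' = v \<and> apath u p a \<and> (a, v) \<in> parcs G \<and> v \<notin> set (pawalk_verts u p)"
  then have "last (pawalk_verts u p) = a"
    by (auto simp: apath_def)
  moreover have "a \<in> set (pawalk_verts u p)"
    using calculation awalk_verts_non_Nil[of u p] last_in_set by force
  ultimately show "apath u (p @ [(a, v)]) v'"
    using * by (auto simp: apath_append_iff apath_simps dest: in_arcsD2)
qed

text \<open>
  Two paths from \<open>u\<close> that enter \<open>v\<close> from \<open>a\<close> and from \<open>b\<close> yield, going backwards along the first and
  then along the second, a connection from \<open>a\<close> to \<open>b\<close> that avoids \<open>v\<close>.  For \<open>a \<noteq> b\<close> it would close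
  up through \<open>v\<close> to a cycle.
\<close>
lemma apath_last_arc_unique:
  assumes p: "apath u (p @ [(a, v)]) v" and q: "apath u (q @ [(b, v)]) v"
  shows "a = b"
proof (rule ccontr)
  assume "a \<noteq> b"
  note p' = p[unfolded apath_snoc_iff] and q' = q[unfolded apath_snoc_iff]
  have wp: "awalk a (rev_path p) u" and wq: "awalk u q b"
    using p' q' by (auto intro: awalkI_apath)
  define s where "s = awalk_to_apath (rev_path p @ q)"
  have w: "awalk a (rev_path p @ q) b"
    using wp wq by (rule awalk_appendI)
  then have s: "apath a s b"
    unfolding s_def by (rule apath_awalk_to_apath)
  have "set (pawalk_verts a (rev_path p @ q)) = set (pawalk_verts u p) \<union> set (pawalk_verts u q)"
    using set_awalk_verts_append[OF wp wq] awalk_verts_rev_path[of u p a] p'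
    by (simp add: apath_def)
  moreover have "set (pawalk_verts a s) \<subseteq> set (pawalk_verts a (rev_path p @ q))"
    using set_awalk_verts[OF w] set_awalk_verts[OF awalkI_apath[OF s]]
      awalk_to_apath_subset[OF w] unfolding s_def[symmetric] by auto
  ultimately have "v \<notin> set (pawalk_verts a s)"
    using p' q' by auto
  then have "apath a (s @ [(b, v)]) v"
    using s q' by (simp add: apath_snoc_iff)
  moreover have "(v, a) \<in> parcs G"
    using p' arcs_symmetric by blast
  ultimately have "length (s @ [(b, v)]) < 2"
    by (rule length_apath_between_adjacent)
  then have "s = []" by simp
  then show False using s \<open>a \<noteq> b\<close> by (simp add: apath_Nil_iff)
qed

lemma apath_unique:
  assumes "apath u p v" "apath u q v"
  shows "p = q"
  using assms
proof (induction p arbitrary: v q rule: rev_induct)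
  case Nil
  then show ?case using apath_nonempty_ends[of u q v] by (auto simp: apath_Nil_iff)
next
  case (snoc e p)
  obtain a where e: "e = (a, v)" and p: "apath u p a"
    using snoc.prems(1) by (cases e) (auto simp: apath_snoc_iff)
  have "u \<noteq> v"
    using snoc.prems(1) apath_nonempty_ends by blast
  then have "q \<noteq> []"
    using snoc.prems(2) by (auto simp: apath_Nil_iff)
  then obtain q' b where q: "q = q' @ [(b, v)]" "apath u q' b"
    using snoc.prems(2) by (cases q rule: rev_cases) (auto simp: apath_snoc_iff)
  have "b = a"
    using apath_last_arc_unique snoc.prems e q(1) by blast
  then show ?case
    using snoc.IH[OF p] q e by blast
qed

section \<open>Levels and children\<close>

definition level :: "nat \<Rightarrow> 'a set" where
  "level k = {v. \<exists>p. apath r p v \<and> length p = k}"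

lemma level_subset_pverts: "level k \<subseteq> pverts G"
  by (auto simp: level_def apath_def)

lemma finite_level: "finite (level k)"
  using level_subset_pverts pair_finite_verts by (rule finite_subset)

lemma in_some_level:
  assumes "v \<in> pverts G"
  obtains k where "v \<in> level k"
proof -
  obtain p where "apath r p v"
    using assms by (rule ex_apath_from_root)
  then have "v \<in> level (length p)"
    by (auto simp: level_def)
  then show thesis by (rule that)
qed

lemma level_unique:
  assumes "v \<in> level i" "v \<in> level j"
  shows "i = j"
proof -
  obtain p q where "apath r p v" "length p = i" and "apath r q v" "length q = j"
    using assms by (auto simp: level_def)
  moreover from this have "p = q"
    by (intro apath_unique)
  ultimately show ?thesis by simp
qed

lemma level_0: "level 0 = {r}"
  using root_in_pverts by (auto simp: level_def apath_Nil_iff)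

lemma child_iff: "w \<in> children G r v \<longleftrightarrow> (\<exists>p. apath r (p @ [(v, w)]) w)"
  by (simp add: children_def)

lemma child_arc: "w \<in> children G r v \<Longrightarrow> (v, w) \<in> parcs G"
  by (auto simp: child_iff apath_snoc_iff)

lemma finite_children: "finite (children G r v)"
  by (rule finite_subset[OF _ pair_finite_verts]) (auto dest: child_arc in_arcsD2)

lemma parent_unique: "w \<in> children G r v \<Longrightarrow> w \<in> children G r v' \<Longrightarrow> v = v'"
  unfolding child_iff by (elim exE) (rule apath_last_arc_unique)

lemma child_level:
  assumes "v \<in> level k" "w \<in> children G r v"
  shows "w \<in> level (Suc k)"
proof -
  obtain p where p: "apath r (p @ [(v, w)]) w"
    using assms(2) by (auto simp: child_iff)
  then have "apath r p v"
    by (simp add: apath_snoc_iff)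
  then have "length p = k"
    using assms(1) apath_unique unfolding level_def by blast
  then show ?thesis using p by (auto simp: level_def)
qed

lemma level_Suc: "level (Suc k) = (\<Union>v\<in>level k. children G r v)"
proof
  show "(\<Union>v\<in>level k. children G r v) \<subseteq> level (Suc k)"
    using child_level by blast
  show "level (Suc k) \<subseteq> (\<Union>v\<in>level k. children G r v)"
  proof
    fix w assume "w \<in> level (Suc k)"
    then obtain p where p: "apath r p w" "length p = Suc k"
      by (auto simp: level_def)
    then obtain q v where q: "p = q @ [(v, w)]"
      by (cases p rule: rev_cases) (auto simp: apath_snoc_iff)
    then have "v \<in> level k" "w \<in> children G r v"
      using p by (auto simp: apath_snoc_iff level_def child_iff)
    then show "w \<in> (\<Union>v\<in>level k. children G r v)" by blast
  qed
qed

text \<open>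
  If the path to \<open>u\<close> avoids \<open>v\<close>, the arc \<open>(u, v)\<close> extends it.  Otherwise the part of this path
  from \<open>v\<close> to \<open>u\<close> joins adjacent vertices and so is the single arc \<open>(v, u)\<close>.
\<close>
lemma arc_imp_child:
  assumes uv: "(u, v) \<in> parcs G"
  shows "v \<in> children G r u \<or> u \<in> children G r v"
proof -
  obtain p where p: "apath r p u"
    using uv in_arcsD1 ex_apath_from_root by blast
  show ?thesis
  proof (cases "v \<in> set (pawalk_verts r p)")
    case False
    then show ?thesis using p uv by (auto simp: child_iff apath_snoc_iff)
  next
    case True
    then obtain q s where qs: "p = q @ s" "awalk r q v" "awalk v s u"
      using awalk_decomp[OF awalkI_apath[OF p]] by blast
    then have s: "apath v s u"
      using p awlast_of_awalk by (auto simp: apath_append_iff)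
    then have "length s < 2"
      using uv by (rule length_apath_between_adjacent)
    moreover have "s \<noteq> []"
      using s no_loops'[OF uv] by (auto simp: apath_Nil_iff)
    ultimately have "length s = 1"
      by (cases s) auto
    then have "s = [(v, u)]"
      using s by (auto simp: length_Suc_conv apath_simps)
    then show ?thesis using p qs(1) by (auto simp: child_iff)
  qed
qed

text \<open>
  The distance is an infimum over all walks, but a cheapest walk may be taken to be a path, and
  there is only one.
\<close>
lemma graph_dist_level:
  assumes "v \<in> level k"
  shows "graph_dist G r v = ereal (real k)"
proof -
  obtain p where p: "apath r p v" "length p = k"
    using assms by (auto simp: level_def)
  then have "r \<rightarrow>\<^sup>*\<^bsub>with_proj G\<^esub> v"
    using reachable_apath by blast
  then obtain q where q: "apath r q v" "\<mu> (\<lambda>_. 1) r v = ereal (awalk_cost (\<lambda>_. 1) q)"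
    using min_cost_awalk[of r v "\<lambda>_. 1"] by auto
  have "awalk_cost (\<lambda>_. 1) q = real k"
    using apath_unique[OF p(1) q(1)] p(2) by (simp add: awalk_cost_def sum_list_triv)
  then show ?thesis using q(2) by (simp add: graph_dist_def)
qed

end

section \<open>Perfect binary trees\<close>

text \<open>
  This is \<open>2 ^ (h - 1) + 2 ^ (h - 3) + \<dots>\<close>; passing from \<open>h\<close> to \<open>h + 2\<close> only adds the
  term \<open>2 ^ (h + 1)\<close>.
\<close>
lemma sum_alternate_powers_of_2:
  "(\<Sum>k | k < h \<and> odd (h - k). 2 ^ k :: real) = (2 ^ (h + 2) - (3 + (- 1) ^ h)) / 6"
proof (induction h rule: induct_nat_012)
  case 0
  then show ?case by simp
next
  case 1
  have "{k. k < Suc 0 \<and> odd (Suc 0 - k)} = {0}" by auto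
  then show ?case by simp
next
  case (ge2 h)
  have "{k. k < Suc (Suc h) \<and> odd (Suc (Suc h) - k)} = insert (Suc h) {k. k < h \<and> odd (h - k)}"
    by (auto simp: less_Suc_eq Suc_diff_le)
  then show ?case using ge2(1) by (simp add: field_simps)
qed

locale perfect_pair_tree = rooted_pair_tree +
  fixes h :: nat
  assumes perfect: "perfect_binary_tree G r h"
begin

lemma leaf_level:
  assumes "leaf G r v"
  shows "v \<in> level h"
proof -
  obtain k where k: "v \<in> level k"
    using assms in_some_level[of v] by (auto simp: leaf_def)
  have "graph_dist G r v = ereal (real h)"
    using perfect assms by (auto simp: perfect_binary_tree_def)
  then show ?thesis using k graph_dist_level[OF k] by simp
qed

lemma card_children:
  assumes "v \<in> level k" "k \<noteq> h"
  shows "card (children G r v) = 2"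
proof -
  have "\<not> leaf G r v"
    using level_unique[OF assms(1) leaf_level] assms(2) by blast
  moreover have "v \<in> pverts G"
    using assms(1) level_subset_pverts by blast
  ultimately show ?thesis
    using perfect unfolding perfect_binary_tree_def by blast
qed

lemma ex_child:
  assumes "v \<in> level k" "k \<noteq> h"
  obtains w where "w \<in> children G r v"
proof -
  have "children G r v \<noteq> {}"
    using card_children[OF assms] by (intro notI) simp
  then show thesis using that by blast
qed

text \<open>
  Below a vertex deeper than \<open>h\<close> there would be no leaf, so the levels after it would all be
  nonempty; but a path is shorter than the number of vertices.
\<close>
lemma level_le_height:
  assumes "v \<in> level k"
  shows "k \<le> h"
proof (rule ccontr)
  assume "\<not> k \<le> h"
  have "\<exists>w. w \<in> level (k + n)" for n
  proof (induction n)
    case 0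
    then show ?case using assms by auto
  next
    case (Suc n)
    then obtain w where w: "w \<in> level (k + n)" by blast
    moreover have "k + n \<noteq> h"
      using \<open>\<not> k \<le> h\<close> by simp
    ultimately obtain x where "x \<in> children G r w"
      by (rule ex_child)
    then show ?case using w child_level by auto
  qed
  then obtain w where "w \<in> level (k + card (pverts G))" by blast
  then obtain p where "apath r p w" "length p = k + card (pverts G)"
    by (auto simp: level_def)
  then show False
    using length_apath_less[of r p w] by simp
qed

lemma card_level: "k \<le> h \<Longrightarrow> card (level k) = 2 ^ k"
proof (induction k)
  case 0
  then show ?case by (simp add: level_0)
next
  case (Suc k)
  have "card (level (Suc k)) = (\<Sum>v\<in>level k. card (children G r v))"
    unfolding level_Suc
    using finite_level finite_children by (intro card_UN_disjoint) (auto dest: parent_unique)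
  also have "\<dots> = (\<Sum>v\<in>level k. 2)"
    using Suc.prems by (intro sum.cong refl card_children) auto
  finally show ?case using Suc by simp
qed

definition alternate_levels :: "'a set" where
  "alternate_levels = (\<Union>k\<in>{k. k < h \<and> odd (h - k)}. level k)"

lemma vertex_cover_alternate_levels: "vertex_cover G alternate_levels"
proof -
  have child: "v \<in> alternate_levels \<or> w \<in> alternate_levels" if w: "w \<in> children G r v" for v w
  proof -
    obtain k where k: "v \<in> level k"
      using in_some_level[OF in_arcsD1[OF child_arc[OF w]]] by blast
    then have wk: "w \<in> level (Suc k)"
      using w child_level by blast
    then have "k < h"
      using level_le_height Suc_le_eq by blast
    show ?thesis
    proof (cases "odd (h - k)")
      case True
      then show ?thesis using k \<open>k < h\<close> by (auto simp: alternate_levels_def)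
    next
      case False
      then have "Suc k < h \<and> odd (h - Suc k)"
        using \<open>k < h\<close> by (cases "Suc k = h") auto
      then show ?thesis using wk unfolding alternate_levels_def by blast
    qed
  qed
  have "u \<in> alternate_levels \<or> v \<in> alternate_levels" if "(u, v) \<in> parcs G" for u v
    using arc_imp_child[OF that] child by blast
  then show ?thesis
    using level_subset_pverts by (auto simp: vertex_cover_def alternate_levels_def)
qed

lemma child_of_alternate_level:
  assumes "v \<in> alternate_levels" "w \<in> children G r v"
  shows "w \<notin> alternate_levels"
proof
  assume "w \<in> alternate_levels"
  then obtain j k where "v \<in> level k" "k < h" "odd (h - k)" "w \<in> level j" "odd (h - j)"
    using assms(1) by (auto simp: alternate_levels_def)
  moreover from this have "j = Suc k"
    using level_unique[OF _ child_level[OF _ assms(2)]] by blast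
  ultimately show False by auto
qed

lemma card_alternate_levels: "card alternate_levels = (\<Sum>k | k < h \<and> odd (h - k). 2 ^ k)"
proof -
  have "card alternate_levels = (\<Sum>k | k < h \<and> odd (h - k). card (level k))"
    unfolding alternate_levels_def
    using finite_level by (intro card_UN_disjoint) (auto dest: level_unique)
  then show ?thesis by (simp add: card_level)
qed

lemma vertex_cover_number_eq_card_alternate_levels:
  "vertex_cover_number G = card alternate_levels"
proof -
  have "\<exists>w. w \<in> children G r v" if v: "v \<in> alternate_levels" for v
  proof -
    obtain k where "v \<in> level k" "k < h"
      using v by (auto simp: alternate_levels_def)
    then show ?thesis
      using ex_child by (metis less_irrefl)
  qed
  then obtain m where m: "\<And>v. v \<in> alternate_levels \<Longrightarrow> m v \<in> children G r v"
    by metis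
  show ?thesis
  proof (rule vertex_cover_number_eq_card_matched_cover)
    show "inj_on m alternate_levels"
      using m parent_unique by (metis inj_onI)
  qed (use m pair_finite_verts vertex_cover_alternate_levels child_arc
      child_of_alternate_level in blast)+
qed

end

theorem proposition1p2:
  fixes T :: "'a pair_pre_digraph" and r :: 'a and h :: nat
  assumes "perfect_binary_tree T r h"
  shows "real (vertex_cover_number T) = (2 ^ (h + 2) - (3 + (- 1) ^ h)) / 6"
proof -
  have tree: "rooted_tree T r"
    using assms by (simp add: perfect_binary_tree_def)
  then interpret pair_graph T
    by (simp add: rooted_tree_def graph_tree_def)
  interpret perfect_pair_tree T r h
    by unfold_locales (fact tree, fact assms)
  have "real (vertex_cover_number T) = (\<Sum>k | k < h \<and> odd (h - k). 2 ^ k)"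
    unfolding vertex_cover_number_eq_card_alternate_levels card_alternate_levels by simp
  also have "\<dots> = (2 ^ (h + 2) - (3 + (- 1) ^ h)) / 6"
    by (rule sum_alternate_powers_of_2)
  finally show ?thesis .
qed

end
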